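(* Let $\phi$ be an analytic self-map of the upper half-plane $\mathbb{H}$ of parabolic type, i.e. such that $\phi(z)\to\infty$ and $\phi(z)/z\to1$ as $z\to\infty$ non-tangentially. Let $\{w_n=x_n+iy_n\}_{n=0}^{\infty}\subset\mathbb{H}$ be a backward-iteration sequence with bounded steps for $\phi$ which tends to infinity and is of non-zero-height, i.e. such that $y_n\downarrow\ell_\infty>0$, and assume $x_n\to+\infty$. Let $\tau_n(z)=x_n+y_nz$ and let $\psi=\lim_{n\to\infty}\phi_n\circ\tau_n$ be the associated conjugating map. Then $$\frac{\psi(z)}{z}\longrightarrow\ell_\infty$$ as $z$ tends to infinity non-tangentially.
   Context: $\mathbb{H}=\{z\in\mathbb{C}:\operatorname{Im} z>0\}$, and $d(z,w)=\left|\frac{w-z}{w-\overline{z}}\right|$ is the pseudo-hyperbolic distance on $\mathbb{H}$. "$z\to\infty$ non-tangentially" means that $z\to\infty$ within a sector $\{|\operatorname{Arg} z-\pi/2|<\theta_0\}$, for each $\theta_0\in(0,\pi/2)$. A backward-iteration sequence with bounded steps for $\phi$ is a sequence with $\phi(w_{n+1})=w_n$ and $d(w_n,w_{n+1})\le a'<1$ for all $n\ge0$ and some constant $a'$; by Schwarz-Pick $d(w_n,w_{n+1})$ is then non-decreasing, with limit denoted $a<1$. $\downarrow$ denotes non-increasing convergence. $\phi_n$ denotes the $n$-th iterate of $\phi$. It is known (another theorem of the paper) that if such a sequence tends to infinity with $\operatorname{Arg} w_n\to0$, then $\phi_n\circ\tau_n$ converges uniformly on compact subsets of $\mathbb{H}$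 to an analytic self-map $\psi$ of $\mathbb{H}$ with $\psi(z-b_0)=\phi\circ\psi(z)$, where $b_0=\frac{2a}{\sqrt{1-a^2}}=\lim_n\frac{x_{n+1}-x_n}{y_n}$; this is the conjugating map $\psi$ of the claim. *)

theory Defs
  imports "HOL-Complex_Analysis.Complex_Analysis"
begin

definition upper_half_plane :: "complex set" where
  "upper_half_plane = {z. Im z > 0}"

definition pseudo_hyperbolic_dist :: "complex \<Rightarrow> complex \<Rightarrow> real" where
  "pseudo_hyperbolic_dist z w = cmod ((w - z) / (w - cnj z))"

(* Tending to a limit along this filter means tending to it as z tends to infinity within the
   sector {z. |Arg z - pi/2| < t}, for each t in (0, pi/2) separately (no uniformity in t);
   see filterlim_nontangential_iff. *)
definition nontangential_at_infinity :: "complex filter" where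
  "nontangential_at_infinity =
     (SUP t\<in>{0<..<pi/2}. inf at_infinity (principal {z. \<bar>Arg z - pi/2\<bar> < t}))"

lemma filterlim_nontangential_iff:
  "filterlim f F nontangential_at_infinity \<longleftrightarrow>
     (\<forall>t. 0 < t \<and> t < pi/2 \<longrightarrow>
        filterlim f F (inf at_infinity (principal {z. \<bar>Arg z - pi/2\<bar> < t})))"
  unfolding nontangential_at_infinity_def filterlim_def filtermap_SUP SUP_le_iff by auto

definition analytic_self_map :: "(complex \<Rightarrow> complex) \<Rightarrow> bool" where
  "analytic_self_map \<phi> \<longleftrightarrow>
     \<phi> holomorphic_on upper_half_plane \<and> \<phi> ` upper_half_plane \<subseteq> upper_half_plane"

definition parabolic_type :: "(complex \<Rightarrow> complex) \<Rightarrow> bool" where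
  "parabolic_type \<phi> \<longleftrightarrow>
     filterlim \<phi> at_infinity nontangential_at_infinity \<and>
     ((\<lambda>z. \<phi> z / z) \<longlongrightarrow> 1) nontangential_at_infinity"

definition backward_iteration_seq :: "(complex \<Rightarrow> complex) \<Rightarrow> (nat \<Rightarrow> complex) \<Rightarrow> bool" where
  "backward_iteration_seq \<phi> w \<longleftrightarrow>
     (\<forall>n. w n \<in> upper_half_plane) \<and> (\<forall>n. \<phi> (w (Suc n)) = w n)"

definition bounded_steps :: "(nat \<Rightarrow> complex) \<Rightarrow> bool" where
  "bounded_steps w \<longleftrightarrow> (\<exists>a'<1. \<forall>n. pseudo_hyperbolic_dist (w n) (w (Suc n)) \<le> a')"

definition nonzero_height :: "(nat \<Rightarrow> complex) \<Rightarrow> real \<Rightarrow> bool" where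
  "nonzero_height w l \<longleftrightarrow>
     decseq (\<lambda>n. Im (w n)) \<and> (\<lambda>n. Im (w n)) \<longlonglongrightarrow> l \<and> l > 0"

definition tau :: "(nat \<Rightarrow> complex) \<Rightarrow> nat \<Rightarrow> complex \<Rightarrow> complex" where
  "tau w n z = of_real (Re (w n)) + of_real (Im (w n)) * z"

(* The limit is meaningful only for z in the upper half-plane, and only when it exists; for
   backward-iteration sequences with bounded steps tending to infinity with Arg (w n) tending
   to 0, the convergence is in fact uniform on compact subsets of the upper half-plane. *)
definition conjugating_map ::
  "(complex \<Rightarrow> complex) \<Rightarrow> (nat \<Rightarrow> complex) \<Rightarrow> complex \<Rightarrow> complex" where
  "conjugating_map \<phi> w z = lim (\<lambda>n. ((\<phi> ^^ n) \<circ> tau w n) z)"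

end

theory Submission
  imports Defs
begin

text \<open>
  By the Schwarz-Pick inequality and Julia's lemma, \<open>Im (\<phi> z) \<ge> Im z\<close>, so for
  \<open>\<psi>\<^sub>n = \<phi>\<^sub>n \<circ> \<tau>\<^sub>n\<close> the function \<open>\<psi>\<^sub>n z - y\<^sub>n z\<close> has nonnegative imaginary part.

  Convergence: \<open>\<psi>\<^sub>n\<^sub>+\<^sub>1 = \<psi>\<^sub>n \<circ> h\<^sub>n\<close> with \<open>h\<^sub>n \<i> = \<i>\<close> and
  \<open>Im (h\<^sub>n z) \<ge> (y\<^sub>n\<^sub>+\<^sub>1 / y\<^sub>n) Im z\<close>. Schwarz-Pick for \<open>h\<^sub>n z - (y\<^sub>n\<^sub>+\<^sub>1 / y\<^sub>n) z\<close> bounds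
  \<open>\<bar>h\<^sub>n z - z\<bar>\<close> by a constant times \<open>1 - y\<^sub>n\<^sub>+\<^sub>1 / y\<^sub>n\<close>, which is summable because the height
  is nonzero.

  Asymptotics: at \<open>\<zeta> = \<tau>\<^sub>n\<^sup>-\<^sup>1 (w\<^sub>n\<^sub>+\<^sub>k)\<close>, which stays bounded in \<open>n\<close>, the function
  \<open>\<psi>\<^sub>n z - y\<^sub>n z\<close> has imaginary part \<open>y\<^sub>k - y\<^sub>n\<^sub>+\<^sub>k \<le> y\<^sub>k - l\<close>. Comparing \<open>z\<close> with \<open>\<zeta>\<close> by
  Schwarz-Pick and letting \<open>n\<close> tend to infinity bounds \<open>\<bar>\<psi> z / z - l\<bar>\<close> in a sector by
  \<open>O(y\<^sub>k - l) + o(1)\<close>, for every \<open>k\<close>.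
\<close>

section \<open>Schwarz-Pick inequalities on the upper half-plane\<close>

lemma norm_diff_cnj_sq: "(cmod (z - cnj w))\<^sup>2 = (cmod (z - w))\<^sup>2 + 4 * Im z * Im w"
  unfolding cmod_power2 by (simp add: power2_eq_square algebra_simps)

lemma diff_cnj_nz: "0 < Im z \<Longrightarrow> 0 < Im w \<Longrightarrow> z - cnj w \<noteq> 0"
  by (auto simp: complex_eq_iff)

lemma norm_diff_less_norm_diff_cnj:
  assumes "0 < Im z" "0 < Im w"
  shows "cmod (z - w) < cmod (z - cnj w)"
proof (rule power2_less_imp_less)
  show "(cmod (z - w))\<^sup>2 < (cmod (z - cnj w))\<^sup>2"
    unfolding norm_diff_cnj_sq using assms by simp
qed simp

text \<open>Cayley transforms sending \<open>w\<close> and \<open>f w\<close> to 0 turn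
  \<open>f\<close> into a self-map of the unit disc fixing 0, to which Schwarz's lemma
  applies.\<close>

lemma Schwarz_Pick_upper_half_plane:
  assumes f: "f holomorphic_on {z. 0 < Im z}" and pos: "\<And>z. 0 < Im z \<Longrightarrow> 0 < Im (f z)"
    and z: "0 < Im z" and w: "0 < Im w"
  shows "cmod (f z - f w) * cmod (z - cnj w) \<le> cmod (z - w) * cmod (f z - cnj (f w))"
proof -
  \<comment> \<open>Inverse of the Cayley transform \<open>z \<mapsto> (z - w) / (z - cnj w)\<close>.\<close>
  define S where "S = (\<lambda>u. (w - cnj w * u) / (1 - u))"
  have nz: "1 - u \<noteq> 0" if "cmod u < 1" for u using that by auto
  have ImS: "0 < Im (S u)" if u: "cmod u < 1" for u
  proof -
    \<comment> \<open>The left side is \<open>2 * \<i>\<close> times the imaginary part of numerator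
      times conjugate denominator, which has the sign of \<open>Im (S u)\<close>.\<close>
    have "(w - cnj w * u) * cnj (1 - u) - cnj ((w - cnj w * u) * cnj (1 - u))
        = (w - cnj w) * (1 - u * cnj u)"
      by (simp add: algebra_simps)
    moreover have "u * cnj u = of_real ((cmod u)\<^sup>2)"
      by (metis complex_norm_square)
    ultimately have "Im ((w - cnj w * u) * cnj (1 - u)) = Im w * (1 - (cmod u)\<^sup>2)"
      by (simp add: complex_eq_iff algebra_simps)
    moreover have "(cmod u)\<^sup>2 < 1" using u by (simp add: abs_square_less_1)
    ultimately have "0 < Im ((w - cnj w * u) * cnj (1 - u))" using w by simp
    then show ?thesis unfolding S_def Im_complex_div_gt_0 .
  qed
  define F where "F = (\<lambda>u. (f (S u) - f w) / (f (S u) - cnj (f w)))"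
  have "S holomorphic_on ball 0 1"
    unfolding S_def by (intro holomorphic_intros) (use nz in auto)
  then have "f \<circ> S holomorphic_on ball 0 1"
    by (rule holomorphic_on_compose_gen[OF _ f]) (use ImS in auto)
  then have fS: "(\<lambda>u. f (S u)) holomorphic_on ball 0 1" by (simp add: o_def)
  have "F holomorphic_on ball 0 1"
    unfolding F_def
    by (intro holomorphic_intros fS) (use ImS pos w in \<open>auto simp: diff_cnj_nz simp del: right_minus_eq\<close>)
  moreover have "F 0 = 0" by (simp add: F_def S_def)
  moreover have "cmod (F u) < 1" if "cmod u < 1" for u
    unfolding F_def norm_divide using norm_diff_less_norm_diff_cnj[OF pos[OF ImS[OF that]] pos[OF w]]
    by (smt (verit) divide_less_eq_1_pos norm_ge_zero)
  moreover define u where "u = (z - w) / (z - cnj w)"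
  have u: "cmod u < 1"
    unfolding u_def norm_divide using norm_diff_less_norm_diff_cnj[OF z w]
    by (smt (verit) divide_less_eq_1_pos norm_ge_zero)
  ultimately have le: "cmod (F u) \<le> cmod u"
    by (intro Schwarz_Lemma(1)) auto
  have "S u = z"
    using diff_cnj_nz[OF z w] diff_cnj_nz[OF w w] unfolding S_def u_def
    by (simp add: divide_simps) (simp add: algebra_simps)
  then have "cmod (f z - f w) / cmod (f z - cnj (f w)) \<le> cmod (z - w) / cmod (z - cnj w)"
    using le by (simp add: F_def u_def norm_divide)
  moreover have "cmod (f z - cnj (f w)) > 0" "cmod (z - cnj w) > 0"
    using diff_cnj_nz pos z w by (simp_all del: right_minus_eq)
  ultimately show ?thesis by (simp add: field_simps)
qed

lemma Schwarz_Pick_Im: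
  assumes f: "f holomorphic_on {z. 0 < Im z}" and nonneg: "\<And>z. 0 < Im z \<Longrightarrow> 0 \<le> Im (f z)"
    and z: "0 < Im z" and w: "0 < Im w"
  shows "(cmod (f z - cnj (f w)))\<^sup>2 * (Im z * Im w) \<le> (cmod (z - cnj w))\<^sup>2 * (Im (f z) * Im (f w))"
proof -
  \<comment> \<open>\<open>f\<close> may take real values, so the strict version applies only after a shift into the
    half-plane.\<close>
  define g where "g = (\<lambda>e z. f z + \<i> * complex_of_real e)"
  have "(cmod (g e z - cnj (g e w)))\<^sup>2 * (Im z * Im w) \<le> (cmod (z - cnj w))\<^sup>2 * (Im (g e z) * Im (g e w))"
    if "0 < e" for e
  proof -
    have "cmod (g e z - g e w) * cmod (z - cnj w) \<le> cmod (z - w) * cmod (g e z - cnj (g e w))"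
    proof (rule Schwarz_Pick_upper_half_plane[OF _ _ z w])
      show "g e holomorphic_on {z. 0 < Im z}"
        unfolding g_def by (intro holomorphic_intros f)
      show "0 < Im (g e z)" if "0 < Im z" for z
        using nonneg[OF that] \<open>0 < e\<close> by (simp add: g_def)
    qed
    then have "(cmod (g e z - g e w) * cmod (z - cnj w))\<^sup>2 \<le> (cmod (z - w) * cmod (g e z - cnj (g e w)))\<^sup>2"
      by (intro power_mono) auto
    then show ?thesis
      unfolding power_mult_distrib norm_diff_cnj_sq by (simp add: algebra_simps)
  qed
  then have "\<forall>\<^sub>F e in at_right 0. (cmod (g e z - cnj (g e w)))\<^sup>2 * (Im z * Im w)
        \<le> (cmod (z - cnj w))\<^sup>2 * (Im (g e z) * Im (g e w))"
    by (auto simp: eventually_at_right_less intro: eventually_mono[OF eventually_at_right_less])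
  moreover have "((\<lambda>e. g e v) \<longlongrightarrow> f v) (at_right 0)" for v
    unfolding g_def by (auto intro!: tendsto_eq_intros)
  ultimately show ?thesis
    by (intro tendsto_le[OF _ _ _ \<open>eventually _ _\<close>] tendsto_intros) auto
qed

text \<open>Dropping the conjugates lowers both sides by the same product of the four imaginary
  parts.\<close>

lemma Schwarz_Pick_Im_diff:
  assumes "f holomorphic_on {z. 0 < Im z}" and "\<And>z. 0 < Im z \<Longrightarrow> 0 \<le> Im (f z)"
    and "0 < Im z" and "0 < Im w"
  shows "(cmod (f z - f w))\<^sup>2 * (Im z * Im w) \<le> (cmod (z - w))\<^sup>2 * (Im (f z) * Im (f w))"
  using Schwarz_Pick_Im[OF assms] unfolding norm_diff_cnj_sq by (simp add: algebra_simps)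

text \<open>\<open>Im (f z)\<close> is at most the norm on the left, so one factor of the squared
  norm divides out. What remains is linear in \<open>Im (f w)\<close>: a small imaginary part at one
  point controls \<open>f\<close> everywhere.\<close>

lemma Schwarz_Pick_bound:
  assumes "f holomorphic_on {z. 0 < Im z}" and nonneg: "\<And>z. 0 < Im z \<Longrightarrow> 0 \<le> Im (f z)"
    and z: "0 < Im z" and w: "0 < Im w"
  shows "cmod (f z - cnj (f w)) \<le> (cmod (z - cnj w))\<^sup>2 * Im (f w) / (Im z * Im w)"
proof (cases "f z - cnj (f w) = 0")
  case True
  with nonneg[OF w] z w show ?thesis by simp
next
  case False
  have "Im (f z) \<le> cmod (f z - cnj (f w))"
    using abs_Im_le_cmod[of "f z - cnj (f w)"] nonneg[OF w] by simp
  then have "(cmod (z - cnj w))\<^sup>2 * (Im (f z) * Im (f w))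
      \<le> (cmod (z - cnj w))\<^sup>2 * (cmod (f z - cnj (f w)) * Im (f w))"
    using nonneg[OF w] by (intro mult_left_mono mult_right_mono) auto
  with Schwarz_Pick_Im[OF assms] have
    "cmod (f z - cnj (f w)) * (cmod (f z - cnj (f w)) * (Im z * Im w)) 
      \<le> cmod (f z - cnj (f w)) * ((cmod (z - cnj w))\<^sup>2 * Im (f w))"
    by (simp add: power2_eq_square algebra_simps)
  then show ?thesis using False z w
    by (simp add: divide_simps mult.assoc)
qed

section \<open>Julia's lemma and the geometry of sectors\<close>

lemma Julia_Im_le:
  assumes f: "f holomorphic_on {z. 0 < Im z}" and nonneg: "\<And>z. 0 < Im z \<Longrightarrow> 0 \<le> Im (f z)"
    and lim: "((\<lambda>t. f (\<i> * of_real t) / (\<i> * of_real t)) \<longlongrightarrow> 1) at_top"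
    and z: "0 < Im z"
  shows "Im z \<le> Im (f z)"
proof -
  define q where "q = (\<lambda>t::real. f (\<i> * of_real t) / (\<i> * of_real t))"
  have q: "(q \<longlongrightarrow> 1) at_top" using lim by (simp add: q_def)
  have inv: "((\<lambda>t::real. c / of_real t :: complex) \<longlongrightarrow> 0) at_top" for c
    by (rule tendsto_divide_0[OF tendsto_const]) (rule filterlim_of_real_at_infinity)
  \<comment> \<open>This is Schwarz-Pick between \<open>\<i> * of_real t\<close> and
    \<open>z\<close> divided by \<open>t^3\<close>. As \<open>t\<close> grows, both squared norms
    tend to 1 and \<open>Re (q t)\<close> tends to 1.\<close>
  have ev: "\<forall>\<^sub>F t in at_top. (cmod (\<i> * q t - cnj (f z) / of_real t))\<^sup>2 * Im z 
      \<le> (cmod (\<i> - cnj z / of_real t))\<^sup>2 * (Re (q t) * Im (f z))"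
    using eventually_gt_at_top[of 0]
  proof eventually_elim
    case (elim t)
    have fq: "f (\<i> * of_real t) = of_real t * (\<i> * q t)" using elim by (simp add: q_def)
    have a: "f (\<i> * of_real t) - cnj (f z) = of_real t * (\<i> * q t - cnj (f z) / of_real t)"
      using elim unfolding fq by (simp add: algebra_simps)
    have b: "\<i> * of_real t - cnj z = of_real t * (\<i> - cnj z / of_real t)"
      using elim by (simp add: algebra_simps)
    have c: "Im (f (\<i> * of_real t)) = t * Re (q t)"
      unfolding fq by simp
    have "(cmod (f (\<i> * of_real t) - cnj (f z)))\<^sup>2 * (Im (\<i> * of_real t) * Im z)
       \<le> (cmod (\<i> * of_real t - cnj z))\<^sup>2 * (Im (f (\<i> * of_real t)) * Im (f z))"
      by (rule Schwarz_Pick_Im[OF f nonneg _ z]) (use elim in auto)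
    then have "t^3 * ((cmod (\<i> * q t - cnj (f z) / of_real t))\<^sup>2 * Im z)
      \<le> t^3 * ((cmod (\<i> - cnj z / of_real t))\<^sup>2 * (Re (q t) * Im (f z)))"
      unfolding a b c norm_mult power_mult_distrib
      by (simp add: power2_eq_square power3_eq_cube mult_ac)
    then show ?case using elim by simp
  qed
  have "(cmod (\<i> * 1 - 0))\<^sup>2 * Im z \<le> (cmod (\<i> - 0))\<^sup>2 * (Re 1 * Im (f z))"
    by (rule tendsto_le[OF _ _ _ ev]) (intro tendsto_intros q inv trivial_limit_at_top_linorder)+
  then show ?thesis by simp
qed

text \<open>The sine of \<open>Arg z\<close> is the cosine of its deviation from
  \<open>pi/2\<close>; so in a sector \<open>Im z\<close> is comparable with
  \<open>cmod z\<close>.\<close>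

lemma sector_imp_norm_le_Im:
  assumes "0 < t" "t < pi/2" "\<bar>Arg z - pi/2\<bar> < t"
  shows "cmod z * cos t \<le> Im z"
proof -
  have "cos t \<le> cos \<bar>Arg z - pi/2\<bar>"
    using assms by (intro cos_monotone_0_pi_le) auto
  also have "\<dots> = sin (Arg z)"
    by (simp add: cos_diff)
  finally have "cmod z * cos t \<le> cmod z * sin (Arg z)" by (simp add: mult_left_mono)
  also have "\<dots> = Im z"
    by (metis Im_rcis rcis_cmod_Arg)
  finally show ?thesis .
qed


text \<open>\<open>Im_le\<close> carries what parabolic type yields through Julia's lemma;
  \<open>step_le\<close> is the Euclidean form of bounded hyperbolic steps at bounded
  height.\<close>

locale nonzero_height_orbit =
  fixes \<phi> :: "complex \<Rightarrow> complex" and w :: "nat \<Rightarrow> complex" and l C :: real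
  assumes holo: "\<phi> holomorphic_on {z. 0 < Im z}"
    and Im_le: "0 < Im z \<Longrightarrow> Im z \<le> Im (\<phi> z)"
    and step: "\<phi> (w (Suc n)) = w n"
    and dec: "decseq (\<lambda>n. Im (w n))"
    and height: "(\<lambda>n. Im (w n)) \<longlonglongrightarrow> l"
    and l_pos: "0 < l"
    and step_le: "cmod (w (Suc n) - w n) \<le> C"
begin

section \<open>Iterates and rescaled iterates along the orbit\<close>

lemma l_le: "l \<le> Im (w n)"
  using decseq_ge[OF dec height] .

lemma Im_w_pos: "0 < Im (w n)"
  using l_le[of n] l_pos by linarith

lemma Im_w_le: "Im (w n) \<le> Im (w 0)"
  using dec by (simp add: decseq_def)

lemma Im_le_iter: "0 < Im z \<Longrightarrow> Im z \<le> Im ((\<phi> ^^ n) z)"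
proof (induction n)
  case (Suc n)
  then show ?case using Im_le[of "(\<phi> ^^ n) z"] by simp
qed simp

lemma holo_iter: "(\<phi> ^^ n) holomorphic_on {z. 0 < Im z}"
proof (induction n)
  case 0
  show ?case by (simp add: id_def)
next
  case (Suc n)
  have "\<phi> \<circ> (\<phi> ^^ n) holomorphic_on {z. 0 < Im z}"
    by (rule holomorphic_on_compose_gen[OF Suc holo]) (auto intro: less_le_trans[OF _ Im_le_iter])
  then show ?case by (simp add: o_def)
qed

lemma iter_w: "(\<phi> ^^ n) (w (n + k)) = w k"
  by (induction n) (simp_all add: funpow_swap1 step)

definition psi :: "nat \<Rightarrow> complex \<Rightarrow> complex" where
  "psi n z = (\<phi> ^^ n) (tau w n z)"

lemma Im_tau: "Im (tau w n z) = Im (w n) * Im z"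
  by (simp add: tau_def)

lemma holo_psi: "psi n holomorphic_on {z. 0 < Im z}"
proof -
  have "tau w n holomorphic_on {z. 0 < Im z}"
    unfolding tau_def by (intro holomorphic_intros)
  then have "(\<phi> ^^ n) \<circ> tau w n holomorphic_on {z. 0 < Im z}"
    by (rule holomorphic_on_compose_gen[OF _ holo_iter]) (auto simp: Im_tau Im_w_pos)
  then show ?thesis by (simp add: psi_def[abs_def] o_def)
qed

lemma Im_psi_ge: "0 < Im z \<Longrightarrow> Im (w n) * Im z \<le> Im (psi n z)"
  unfolding psi_def using Im_le_iter[of "tau w n z" n] by (simp add: Im_tau Im_w_pos)

lemma Im_psi_pos: "0 < Im z \<Longrightarrow> 0 < Im (psi n z)"
  using Im_psi_ge[of z n] Im_w_pos[of n] mult_pos_pos[of "Im (w n)" "Im z"] by linarith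

lemma tau_ii: "tau w n \<i> = w n"
  by (simp add: tau_def complex_eq_iff)

lemma psi_ii: "psi n \<i> = w 0"
  using iter_w[of n 0] by (simp add: psi_def tau_ii)

lemma norm_orbit_diff_le: "cmod (w (n + k) - w n) \<le> real k * C"
proof (induction k)
  case (Suc k)
  have "cmod (w (n + Suc k) - w n) \<le> cmod (w (Suc (n + k)) - w (n + k)) + cmod (w (n + k) - w n)"
    using norm_triangle_ineq[of "w (Suc (n + k)) - w (n + k)" "w (n + k) - w n"] by simp
  also have "\<dots> \<le> C + real k * C" using Suc step_le by (intro add_mono)
  finally show ?case by (simp add: algebra_simps)
qed simp

section \<open>Convergence of the rescaled iterates\<close>

lemma psi_convergent:
  assumes z: "0 < Im z"
  shows "convergent (\<lambda>n. psi n z)"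
proof -
  \<comment> \<open>\<open>h n\<close> is \<open>\<phi>\<close> read through
    \<open>tau w (Suc n)\<close> at the source and \<open>tau w n\<close> at the target;
    \<open>d n\<close> is the relative loss of height in one step.\<close>
  define h where "h = (\<lambda>n z. (\<phi> (tau w (Suc n) z) - Re (w n)) / Im (w n))"
  define d where "d = (\<lambda>n. (Im (w n) - Im (w (Suc n))) / Im (w n))"
  have yn: "0 < Im (w n)" "Im (w n) \<noteq> 0" for n using Im_w_pos[of n] by auto
  have tau_h: "tau w n (h n z) = \<phi> (tau w (Suc n) z)" for n z
    using yn by (simp add: tau_def h_def)
  have psi_h: "psi (Suc n) z = psi n (h n z)" for n z
    by (simp add: psi_def tau_h funpow_swap1)
  have d0: "0 \<le> d n" for n
    using decseq_SucD[OF dec, of n] yn(1)[of n] by (simp add: d_def)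
  have d1: "d n \<le> 1" for n using yn(1)[of n] Im_w_pos[of "Suc n"] by (simp add: d_def)
  have holo_h: "h n holomorphic_on {z. 0 < Im z}" for n
  proof -
    have "tau w (Suc n) holomorphic_on {z. 0 < Im z}"
      unfolding tau_def by (intro holomorphic_intros)
    then have "\<phi> \<circ> tau w (Suc n) holomorphic_on {z. 0 < Im z}"
      by (rule holomorphic_on_compose_gen[OF _ holo]) (auto simp: Im_tau Im_w_pos)
    then show ?thesis unfolding h_def o_def
      by (intro holomorphic_intros) (use yn in auto)
  qed
  have Im_h: "(1 - d n) * Im z \<le> Im (h n z)" if "0 < Im z" for n z
    using Im_le[of "tau w (Suc n) z"] that yn by (simp add: Im_tau h_def d_def field_simps)
  have h_ii: "h n \<i> = \<i>" for n
  proof -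
    have "w n - Re (w n) = \<i> * Im (w n)" by (simp add: complex_eq_iff)
    then show ?thesis using yn by (simp add: h_def tau_ii step)
  qed
  \<comment> \<open>The summands of \<open>A\<close> come from Schwarz-Pick based at
    \<open>\<i>\<close>, from \<open>\<i> * d n\<close>, and from the term
    \<open>d n * z\<close>.\<close>
  define A where "A = (cmod (z + \<i>))\<^sup>2 / Im z + 1 + cmod z"
  have h_diff: "cmod (h n z - z) \<le> d n * A" for n
  proof -
    define g where "g = (\<lambda>z::complex. h n z - (1 - d n) * z)"
    have g_ii: "g \<i> = \<i> * d n" by (simp add: g_def h_ii algebra_simps)
    have "cmod (g z - cnj (g \<i>)) \<le> (cmod (z - cnj \<i>))\<^sup>2 * Im (g \<i>) / (Im z * Im \<i>)"
    proof (rule Schwarz_Pick_bound[OF _ _ z])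
      show "g holomorphic_on {z. 0 < Im z}"
        unfolding g_def by (intro holomorphic_intros holo_h)
      show "0 \<le> Im (g z)" if "0 < Im z" for z
        using Im_h[OF that, of n] by (simp add: g_def)
    qed simp
    then have "cmod (g z + \<i> * d n) \<le> (cmod (z + \<i>))\<^sup>2 / Im z * d n"
      by (simp add: g_ii)
    moreover have "cmod (h n z - z) \<le> cmod (g z + \<i> * d n) + d n + d n * cmod z"
    proof -
      have "h n z - z = (g z + \<i> * d n) - \<i> * d n - d n * z"
        by (simp add: g_def algebra_simps)
      then have "cmod (h n z - z) \<le> cmod (g z + \<i> * d n - \<i> * d n) + cmod (d n * z)"
        by (metis norm_triangle_ineq4)
      also have "\<dots> \<le> cmod (g z + \<i> * d n) + cmod (\<i> * d n) + cmod (d n * z)"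
        by (intro add_right_mono norm_triangle_ineq4)
      finally have "cmod (h n z - z) \<le> \<dots>" .
      then show ?thesis using d0[of n] by (simp add: norm_mult)
    qed
    ultimately show ?thesis by (simp add: A_def algebra_simps)
  qed
  have A: "0 \<le> A" using z by (simp add: A_def)
  \<comment> \<open>Every ratio of consecutive heights is at least \<open>l / Im (w 0)\<close>, so
    \<open>m\<close> bounds the heights of all \<open>h n z\<close> from below.\<close>
  define m where "m = l / Im (w 0) * Im z"
  have m: "0 < m" using l_pos Im_w_pos z by (simp add: m_def)
  have m_le: "m \<le> Im (h n z)" for n
  proof -
    have "l / Im (w 0) \<le> Im (w (Suc n)) / Im (w n)"
      by (rule frac_le) (use l_le Im_w_le yn l_pos in \<open>auto simp: less_imp_le\<close>)
    also have "\<dots> = 1 - d n" using yn by (simp add: d_def field_simps)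
    finally have "m \<le> (1 - d n) * Im z" unfolding m_def using z by (intro mult_right_mono) auto
    with Im_h[OF z, of n] show ?thesis by linarith
  qed
  have m_le_z: "m \<le> Im z"
    using z l_le[of 0] yn[of 0] by (simp add: m_def field_simps)
  \<comment> \<open>All \<open>psi n\<close> take the same value \<open>w 0\<close> at
    \<open>\<i>\<close>; Schwarz-Pick based there gives a bound independent of \<open>n\<close> on a
    set containing \<open>z\<close> and every \<open>h n z\<close>.\<close>
  define B where "B = (cmod z + A + 1)\<^sup>2 * Im (w 0) / m"
  have Im_psi_le: "Im (psi n v) \<le> B" if v: "m \<le> Im v" "cmod v \<le> cmod z + A" for n v
  proof -
    have v0: "0 < Im v" using v m by linarith
    have "Im (psi n v) \<le> Im (psi n v - cnj (psi n \<i>))" by (simp add: psi_ii Im_w_pos less_imp_le)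
    also have "\<dots> \<le> cmod (psi n v - cnj (psi n \<i>))" using abs_Im_le_cmod by (metis abs_le_D1)
    also have "\<dots> \<le> (cmod (v - cnj \<i>))\<^sup>2 * Im (psi n \<i>) / (Im v * Im \<i>)"
      by (rule Schwarz_Pick_bound[OF holo_psi _ v0]) (use Im_psi_pos in \<open>auto simp: less_imp_le\<close>)
    also have "\<dots> \<le> (cmod z + A + 1)\<^sup>2 * Im (w 0) / m"
    proof (rule frac_le)
      have "cmod (v - cnj \<i>) \<le> cmod z + A + 1"
        using norm_triangle_ineq4[of v "cnj \<i>"] v by simp
      then show "(cmod (v - cnj \<i>))\<^sup>2 * Im (psi n \<i>) \<le> (cmod z + A + 1)\<^sup>2 * Im (w 0)"
        by (intro mult_mono power_mono) (auto simp: psi_ii Im_w_pos less_imp_le)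
    qed (use m v Im_w_pos[of 0] in auto)
    finally show ?thesis by (simp add: B_def)
  qed
  have "norm (psi (Suc n) z - psi n z) \<le> d n * (A * B / m)" for n
  proof -
    have h0: "0 < Im (h n z)" using m m_le[of n] by linarith
    have "d n * A \<le> A" using A d1[of n] by (simp add: mult_left_le_one_le d0)
    moreover have "cmod (h n z) \<le> cmod z + cmod (h n z - z)" by (rule norm_triangle_sub)
    ultimately have h_le: "cmod (h n z) \<le> cmod z + A" using h_diff[of n] by linarith
    \<comment> \<open>Heights at least \<open>m\<close> before and at most \<open>B\<close> after
      applying \<open>psi n\<close> give the Lipschitz constant \<open>B / m\<close>.\<close>
    have "(cmod (psi n (h n z) - psi n z))\<^sup>2 * (m * m)
        \<le> (cmod (psi n (h n z) - psi n z))\<^sup>2 * (Im (h n z) * Im z)"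
      using m m_le[of n] m_le_z by (intro mult_left_mono mult_mono) auto
    also have "\<dots> \<le> (cmod (h n z - z))\<^sup>2 * (Im (psi n (h n z)) * Im (psi n z))"
      by (rule Schwarz_Pick_Im_diff[OF holo_psi _ h0 z]) (use Im_psi_pos in \<open>auto simp: less_imp_le\<close>)
    also have "\<dots> \<le> (d n * A)\<^sup>2 * (B * B)"
      using h_diff[of n] Im_psi_le[OF m_le h_le, of n] Im_psi_le[OF m_le_z, of n] A
        Im_psi_pos[OF h0, of n] Im_psi_pos[OF z, of n]
      by (intro mult_mono power_mono) auto
    finally have "(cmod (psi n (h n z) - psi n z) * m)\<^sup>2 \<le> (d n * A * B)\<^sup>2"
      by (simp add: power2_eq_square mult_ac)
    moreover have "0 \<le> B" using m Im_w_pos[of 0] by (simp add: B_def)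
    ultimately have "cmod (psi n (h n z) - psi n z) * m \<le> d n * A * B"
      using A d0 by (metis power2_le_imp_le mult_nonneg_nonneg)
    then show ?thesis using m by (simp add: psi_h field_simps)
  qed
  moreover have "summable (\<lambda>n. d n * (A * B / m))"
  proof (rule summable_mult2, rule summable_comparison_test)
    \<comment> \<open>Since heights stay above \<open>l\<close>, which is positive, a telescoping
      series dominates \<open>d n\<close>.\<close>
    have "d n \<le> (Im (w n) - Im (w (Suc n))) / l" for n
      unfolding d_def by (rule frac_le) (use decseq_SucD[OF dec, of n] l_le l_pos in auto)
    then show "\<exists>N. \<forall>n\<ge>N. norm (d n) \<le> (Im (w n) - Im (w (Suc n))) / l"
      by (simp add: d0)
    show "summable (\<lambda>n. (Im (w n) - Im (w (Suc n))) / l)"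
      using telescope_summable'[OF height] by (rule summable_divide)
  qed
  ultimately have "summable (\<lambda>n. psi (Suc n) z - psi n z)"
    by (meson summable_comparison_test')
  then have "convergent (\<lambda>n. \<Sum>i<n. psi (Suc i) z - psi i z)"
    by (simp add: summable_iff_convergent)
  then have "convergent (\<lambda>n. psi n z - psi 0 z)"
    by (simp add: sum_lessThan_telescope[of "\<lambda>n. psi n z"])
  then show ?thesis by (simp add: convergent_diff_const_right_iff)
qed

section \<open>Distance of the rescaled iterates and their limit from a linear map\<close>

lemma psi_diff_bound:
  fixes z :: complex and k :: nat
  assumes z: "0 < Im z"
  defines "R \<equiv> real k * C + Im (w 0)"
  shows "cmod (psi n z - Im (w n) * z)
    \<le> (cmod z + R / l)\<^sup>2 * (Im (w k) - l) * Im (w 0) / (l * Im z) + cmod (w k) + R"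
proof -
  have yn: "0 < Im (w n)" "Im (w n) \<noteq> 0" using Im_w_pos[of n] by auto
  \<comment> \<open>\<open>\<zeta>\<close> is the preimage of \<open>w (n + k)\<close> under
    \<open>tau w n\<close>, and \<open>\<phi> ^^ n\<close> carries that point back to
    \<open>w k\<close>, so \<open>psi n \<zeta>\<close> is known.\<close>
  define \<zeta> where "\<zeta> = (w (n + k) - Re (w n)) / Im (w n)"
  define g where "g = (\<lambda>z::complex. psi n z - Im (w n) * z)"
  have y\<zeta>: "Im (w n) * \<zeta> = (w (n + k) - w n) + \<i> * Im (w n)"
    using yn by (simp add: \<zeta>_def complex_eq_iff)
  \<comment> \<open>\<open>R\<close> accounts for \<open>k\<close> steps of length at most
    \<open>C\<close> and one height of at most \<open>Im (w 0)\<close>.\<close>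
  have "cmod (Im (w n) * \<zeta>) \<le> cmod (w (n + k) - w n) + Im (w n)"
    unfolding y\<zeta> using norm_triangle_ineq[of "w (n + k) - w n" "\<i> * Im (w n)"] yn by (simp add: norm_mult)
  then have norm_y\<zeta>: "cmod (Im (w n) * \<zeta>) \<le> R"
    using norm_orbit_diff_le[of n k] Im_w_le[of n] unfolding R_def by linarith
  have "l * cmod \<zeta> \<le> Im (w n) * cmod \<zeta>" using l_le[of n] by (intro mult_right_mono) auto
  with norm_y\<zeta> yn have norm_\<zeta>: "cmod \<zeta> \<le> R / l"
    using l_pos by (simp add: norm_mult field_simps)
  have Im_\<zeta>: "Im \<zeta> = Im (w (n + k)) / Im (w n)" by (simp add: \<zeta>_def)
  have "l / Im (w 0) \<le> Im \<zeta>"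
    unfolding Im_\<zeta> by (rule frac_le) (use l_le Im_w_le yn l_pos Im_w_pos in \<open>auto simp: less_imp_le\<close>)
  moreover have "0 < l / Im (w 0)" using l_pos Im_w_pos by simp
  ultimately have \<zeta>_pos: "0 < Im \<zeta>" and Im_\<zeta>_ge: "l / Im (w 0) \<le> Im \<zeta>" by linarith+
  have "tau w n \<zeta> = w (n + k)" using yn by (simp add: tau_def \<zeta>_def)
  then have g\<zeta>: "g \<zeta> = w k - Im (w n) * \<zeta>" by (simp add: g_def psi_def iter_w)
  have "Im (g \<zeta>) = Im (w k) - Im (w (n + k))" unfolding g\<zeta> using yn by (simp add: Im_\<zeta>)
  then have Im_g\<zeta>: "Im (g \<zeta>) \<le> Im (w k) - l" using l_le[of "n + k"] by simp
  have norm_g\<zeta>: "cmod (g \<zeta>) \<le> cmod (w k) + R"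
    unfolding g\<zeta> using norm_triangle_ineq4[of "w k" "Im (w n) * \<zeta>"] norm_y\<zeta> by linarith
  have g_nonneg: "0 \<le> Im (g z)" if "0 < Im z" for z
    using Im_psi_ge[OF that, of n] by (simp add: g_def)
  then have g\<zeta>_nonneg: "0 \<le> Im (g \<zeta>)" using \<zeta>_pos by simp
  have "g holomorphic_on {z. 0 < Im z}"
    unfolding g_def by (intro holomorphic_intros holo_psi)
  then have "cmod (g z - cnj (g \<zeta>)) \<le> (cmod (z - cnj \<zeta>))\<^sup>2 * Im (g \<zeta>) / (Im z * Im \<zeta>)"
    using g_nonneg z \<zeta>_pos by (rule Schwarz_Pick_bound)
  also have "\<dots> \<le> (cmod z + R / l)\<^sup>2 * (Im (w k) - l) / (Im z * (l / Im (w 0)))"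
  proof (rule frac_le)
    have "cmod (z - cnj \<zeta>) \<le> cmod z + R / l"
      using norm_triangle_ineq4[of z "cnj \<zeta>"] norm_\<zeta> by simp
    then show "(cmod (z - cnj \<zeta>))\<^sup>2 * Im (g \<zeta>) \<le> (cmod z + R / l)\<^sup>2 * (Im (w k) - l)"
      using Im_g\<zeta> g\<zeta>_nonneg by (intro mult_mono power_mono) auto
    show "Im z * (l / Im (w 0)) \<le> Im z * Im \<zeta>"
      using z Im_\<zeta>_ge by (intro mult_left_mono) auto
  qed (use z l_le[of k] l_pos Im_w_pos[of 0] in auto)
  finally have "cmod (g z - cnj (g \<zeta>)) \<le> (cmod z + R / l)\<^sup>2 * (Im (w k) - l) * Im (w 0) / (l * Im z)"
    by (simp add: mult_ac)
  moreover have "cmod (g z) \<le> cmod (g z - cnj (g \<zeta>)) + cmod (g \<zeta>)"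
    using norm_triangle_sub[of "g z" "cnj (g \<zeta>)"] by simp
  ultimately show ?thesis using norm_g\<zeta> by (simp add: g_def)
qed

text \<open>The preceding bound does not depend on \<open>n\<close>, so it passes to the
  limit.\<close>

lemma conjugating_map_diff_bound:
  fixes z :: complex and k :: nat
  assumes z: "0 < Im z"
  defines "R \<equiv> real k * C + Im (w 0)"
  shows "cmod (conjugating_map \<phi> w z - l * z)
    \<le> (cmod z + R / l)\<^sup>2 * (Im (w k) - l) * Im (w 0) / (l * Im z) + cmod (w k) + R"
proof (rule Lim_bounded)
  have "conjugating_map \<phi> w z = lim (\<lambda>n. psi n z)"
    by (simp add: conjugating_map_def psi_def)
  then have "(\<lambda>n. psi n z) \<longlonglongrightarrow> conjugating_map \<phi> w z"
    using psi_convergent[OF z] by (simp add: convergent_LIMSEQ_iff)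
  then show "(\<lambda>n. cmod (psi n z - Im (w n) * z)) \<longlonglongrightarrow> cmod (conjugating_map \<phi> w z - l * z)"
    by (intro tendsto_intros height)
qed (use psi_diff_bound[OF z] in \<open>simp add: R_def\<close>)

lemma conjugating_map_nontangential:
  "((\<lambda>z. conjugating_map \<phi> w z / z) \<longlongrightarrow> complex_of_real l) nontangential_at_infinity"
  unfolding filterlim_nontangential_iff
proof (intro allI impI tendstoI, elim conjE)
  fix t e :: real
  assume t: "0 < t" "t < pi/2" and e: "0 < e"
  have c: "0 < cos t" using t by (intro cos_gt_zero) auto
  \<comment> \<open>Once \<open>cmod z\<close> is at least \<open>R / l\<close>, the square costs a
    factor 4, and the sector gives \<open>Im z\<close> at least \<open>cmod z * cos t\<close>; the
    quadratic term is then at most \<open>(Im (w k) - l) * D * cmod z\<close>. Hence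
    \<open>k\<close> is fixed before the radius.\<close>
  define D where "D = 4 * Im (w 0) / (l * cos t)"
  have D: "0 < D" using l_pos c Im_w_pos by (simp add: D_def)
  have "\<forall>\<^sub>F k in sequentially. Im (w k) < l + e / (2 * D)"
    using height by (rule order_tendstoD) (use e D in simp)
  then obtain k where "Im (w k) < l + e / (2 * D)"
    by (auto simp: eventually_sequentially)
  then have k: "(Im (w k) - l) * D < e / 2" using D by (simp add: field_simps)
  define R where "R = real k * C + Im (w 0)"
  have R: "0 \<le> R" 
    using step_le[of 0] Im_w_pos[of 0] norm_ge_zero[of "w (Suc 0) - w 0"] unfolding R_def
    by (intro add_nonneg_nonneg mult_nonneg_nonneg) linarith+
  \<comment> \<open>The three thresholds make \<open>z\<close> nonzero, absorb \<open>R / l\<close>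
    into \<open>cmod z\<close>, and bring the constant term below
    \<open>e / 2 * cmod z\<close>.\<close>
  define r where "r = max 1 (max (R / l) (2 * (cmod (w k) + R) / e))"
  have "dist (conjugating_map \<phi> w z / z) l < e"
    if z: "r \<le> cmod z" "\<bar>Arg z - pi/2\<bar> < t" for z
  proof -
    have z0: "0 < cmod z" and zR: "R / l \<le> cmod z" and ze: "2 * (cmod (w k) + R) / e \<le> cmod z"
      using z by (auto simp: r_def)
    have Im_ge: "cmod z * cos t \<le> Im z" by (rule sector_imp_norm_le_Im[OF t z(2)])
    moreover have cz: "0 < cmod z * cos t" using z0 c by simp
    ultimately have Im_pos: "0 < Im z" by linarith
    have "cmod (conjugating_map \<phi> w z - l * z)
        \<le> (cmod z + R / l)\<^sup>2 * (Im (w k) - l) * Im (w 0) / (l * Im z) + (cmod (w k) + R)"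
      using conjugating_map_diff_bound[OF Im_pos, of k] by (simp add: R_def)
    also have "\<dots> \<le> (2 * cmod z)\<^sup>2 * (Im (w k) - l) * Im (w 0) / (l * (cmod z * cos t)) + e / 2 * cmod z"
    proof (intro add_mono frac_le mult_right_mono power_mono mult_left_mono)
      show "cmod (w k) + R \<le> e / 2 * cmod z" using ze e by (simp add: field_simps)
    qed (use zR Im_ge cz l_pos R l_le[of k] Im_w_pos[of 0] in auto)
    also have "\<dots> = ((Im (w k) - l) * D + e / 2) * cmod z"
      using z0 c l_pos by (simp add: D_def field_simps power2_eq_square)
    also have "\<dots> < e * cmod z" using k z0 by (intro mult_strict_right_mono) auto
    finally have "cmod (conjugating_map \<phi> w z - l * z) < e * cmod z" .
    moreover have "conjugating_map \<phi> w z / z - l = (conjugating_map \<phi> w z - l * z) / z"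
      using z0 by (simp add: field_simps)
    ultimately show ?thesis using z0 by (simp add: dist_norm norm_divide field_simps)
  qed
  then show "\<forall>\<^sub>F z in inf at_infinity (principal {z. \<bar>Arg z - pi/2\<bar> < t}).
      dist (conjugating_map \<phi> w z / z) l < e"
    unfolding eventually_inf_principal eventually_at_infinity by auto
qed

end

section \<open>Passage from the original hypotheses to the orbit setting\<close>

lemma filterlim_imaginary_axis_nontangential:
  "filterlim (\<lambda>t. \<i> * complex_of_real t) nontangential_at_infinity at_top"
proof -
  have "filterlim (\<lambda>t. \<i> * complex_of_real t) at_infinity at_top"
    by (rule tendsto_mult_filterlim_at_infinity[OF tendsto_const _ filterlim_of_real_at_infinity]) simp
  moreover have "\<forall>\<^sub>F t in at_top. \<i> * complex_of_real t \<in> {z. \<bar>Arg z - pi/2\<bar> < pi/4}"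
    using eventually_gt_at_top[of 0]
  proof eventually_elim
    case (elim t)
    then show ?case using Arg_times_of_real[of t \<i>] by (simp add: mult.commute)
  qed
  ultimately have "filterlim (\<lambda>t. \<i> * complex_of_real t)
      (inf at_infinity (principal {z. \<bar>Arg z - pi/2\<bar> < pi/4})) at_top"
    by (simp add: filterlim_inf filterlim_principal)
  \<comment> \<open>The non-tangential filter is a supremum over sectors, so approach within a
    single sector suffices.\<close>
  moreover have "inf at_infinity (principal {z. \<bar>Arg z - pi/2\<bar> < pi/4}) \<le> nontangential_at_infinity"
    unfolding nontangential_at_infinity_def by (rule SUP_upper) auto
  ultimately show ?thesis using filterlim_mono by blast
qed

text \<open>\<open>cmod (w - cnj z)\<close> exceeds \<open>cmod (w - z)\<close> by at most
  \<open>2 * Im z\<close>; as \<open>a < 1\<close>, the term \<open>a * cmod (w - z)\<close> is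
  absorbed on the left.\<close>

lemma pseudo_hyperbolic_step_bound:
  assumes "0 < Im z" "0 < Im w" "Im z \<le> y" "pseudo_hyperbolic_dist z w \<le> a" "a < 1"
  shows "cmod (w - z) \<le> 2 * a * y / (1 - a)"
proof -
  have "0 \<le> pseudo_hyperbolic_dist z w" by (simp add: pseudo_hyperbolic_dist_def)
  then have a: "0 \<le> a" using assms by linarith
  have "w - cnj z \<noteq> 0" using diff_cnj_nz assms by blast
  then have le: "cmod (w - z) \<le> a * cmod (w - cnj z)"
    using assms(4) by (simp add: pseudo_hyperbolic_dist_def norm_divide divide_simps)
  have "cmod (w - cnj z) \<le> cmod (w - z) + 2 * y"
  proof -
    have "w - cnj z = (w - z) + (z - cnj z)" by simp
    then have "cmod (w - cnj z) \<le> cmod (w - z) + cmod (z - cnj z)"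
      by (metis norm_triangle_ineq)
    also have "cmod (z - cnj z) = 2 * Im z"
      using assms by (simp add: complex_diff_cnj norm_mult)
    finally show ?thesis using assms by simp
  qed
  then have "a * cmod (w - cnj z) \<le> a * (cmod (w - z) + 2 * y)" using a by (rule mult_left_mono)
  with le show ?thesis using assms(5) by (simp add: field_simps)
qed

theorem proposition1p16:
  fixes \<phi> :: "complex \<Rightarrow> complex" and w :: "nat \<Rightarrow> complex" and l :: real
  assumes "analytic_self_map \<phi>"
    and "parabolic_type \<phi>"
    and "backward_iteration_seq \<phi> w"
    and "bounded_steps w"
    and "filterlim w at_infinity sequentially"
    and "nonzero_height w l"
    and "filterlim (\<lambda>n. Re (w n)) at_top sequentially"
  shows "((\<lambda>z. conjugating_map \<phi> w z / z) \<longlongrightarrow> complex_of_real l) nontangential_at_infinity"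
proof -
  have holo: "\<phi> holomorphic_on {z. 0 < Im z}"
    using assms(1) by (simp add: analytic_self_map_def upper_half_plane_def)
  have pos: "0 < Im (\<phi> z)" if "0 < Im z" for z
    using assms(1) that by (auto simp: analytic_self_map_def upper_half_plane_def)
  have w: "0 < Im (w n)" "\<phi> (w (Suc n)) = w n" for n
    using assms(3) by (auto simp: backward_iteration_seq_def upper_half_plane_def)
  have height: "decseq (\<lambda>n. Im (w n))" "(\<lambda>n. Im (w n)) \<longlonglongrightarrow> l" "0 < l"
    using assms(6) by (auto simp: nonzero_height_def)
  obtain a where a: "a < 1" "\<And>n. pseudo_hyperbolic_dist (w n) (w (Suc n)) \<le> a"
    using assms(4) by (auto simp: bounded_steps_def)
  have "((\<lambda>z. \<phi> z / z) \<longlongrightarrow> 1) nontangential_at_infinity"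
    using assms(2) by (simp add: parabolic_type_def)
  then have lim: "((\<lambda>t. \<phi> (\<i> * of_real t) / (\<i> * of_real t)) \<longlongrightarrow> 1) at_top"
    using filterlim_compose filterlim_imaginary_axis_nontangential by blast
  \<comment> \<open>By monotonicity \<open>Im (w 0)\<close> is the largest height, so one Euclidean
    step bound serves the whole orbit.\<close>
  interpret nonzero_height_orbit \<phi> w l "2 * a * Im (w 0) / (1 - a)"
  proof
    show "Im z \<le> Im (\<phi> z)" if "0 < Im z" for z
      by (rule Julia_Im_le[OF holo _ lim that]) (simp add: pos less_imp_le)
    show "cmod (w (Suc n) - w n) \<le> 2 * a * Im (w 0) / (1 - a)" for n
      by (rule pseudo_hyperbolic_step_bound)
        (use w height(1) a in \<open>auto simp: decseq_def\<close>)
  qed (use w height holo in auto)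
  show ?thesis by (rule conjugating_map_nontangential)
qed

end
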